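(* Let $(\mathfrak{g},g,J_g)$ and $(\mathfrak{h},h,J_h)$ be pseudo-Kähler Lie algebras and let $\varphi:\mathfrak{h}\to\mathrm{Der}(\mathfrak{g})$ be a representation (Lie algebra homomorphism). Let $\tilde{\mathfrak{g}}=\mathfrak{g}\rtimes_\varphi\mathfrak{h}$, with $\tilde g(X+A,Y+B)=g(X,Y)+h(A,B)$ and $\tilde J(X+A)=J_gX+J_hA$ for $X,Y\in\mathfrak{g}$, $A,B\in\mathfrak{h}$. Then $(\tilde{\mathfrak{g}},\tilde g,\tilde J)$ is a pseudo-Kähler Lie algebra if and only if, for all $A\in\mathfrak{h}$, \begin{itemize} \item $J_g\circ\varphi(A)^s=\varphi(J_hA)^s$, and \item $J_g\circ\varphi(A)^a=\varphi(A)^a\circ J_g$. \end{itemize}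
   Context: All Lie algebras are real and finite-dimensional. A pseudo-Kähler Lie algebra is a triple $(\mathfrak{g},g,J)$ where $\mathfrak{g}$ is a real Lie algebra, $g$ is a non-degenerate symmetric bilinear form (of arbitrary signature) on $\mathfrak{g}$, and $J:\mathfrak{g}\to\mathfrak{g}$ is linear with $J^2=-\mathrm{id}$ and $g(J\cdot,J\cdot)=g$, such that $J$ is parallel for the Levi-Civita connection of $g$ (equivalently: the Nijenhuis tensor of $J$ vanishes and the $2$-form $\omega=g(J\cdot,\cdot)$ is closed). Here the Levi-Civita connection $\nabla$ is the bilinear map $\mathfrak{g}\times\mathfrak{g}\to\mathfrak{g}$ given by the Koszul formula $2g(\nabla_XY,Z)=g([X,Y],Z)-g(Y,[X,Z])-g(X,[Y,Z])$. The semidirect product $\mathfrak{g}\rtimes_\varphi\mathfrak{h}$ is the vector space $\mathfrak{g}\oplus\mathfrak{h}$ with bracket $[X+A,Y+B]=[X,Y]_{\mathfrak{g}}+\varphi(A)Y-\varphi(B)X+[A,B]_{\mathfrak{h}}$. For a linear map $f:\mathfrak{g}\to\mathfrak{g}$, $f^*$ is the $g$-adjoint, $g(fX,Y)=g(X,f^*Y)$, and $f^s=\frac12(f+f^* )$, $f^a=\frac12(f-f^* )$ are the $g$-symmetric and $g$-antisymmetric parts of $f$. *)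

theory Defs
  imports "HOL-Analysis.Analysis"
begin

definition lie_bracket :: "('a::real_vector \<Rightarrow> 'a \<Rightarrow> 'a) \<Rightarrow> bool" where
  "lie_bracket br \<longleftrightarrow>
     bilinear br \<and>
     (\<forall>X. br X X = 0) \<and>
     (\<forall>X Y Z. br X (br Y Z) + br Y (br Z X) + br Z (br X Y) = 0)"

text \<open>Lie algebras live on whole types; finite-dimensionality is imposed by a finite
  spanning set, so that the type carries no preferred basis or inner product.\<close>

definition lie_algebra :: "('a::real_vector \<Rightarrow> 'a \<Rightarrow> 'a) \<Rightarrow> bool" where
  "lie_algebra br \<longleftrightarrow>
     lie_bracket br \<and> (\<exists>B :: 'a set. finite B \<and> span B = UNIV)"

definition nondeg_sym_form :: "('a::real_vector \<Rightarrow> 'a \<Rightarrow> real) \<Rightarrow> bool" where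
  "nondeg_sym_form g \<longleftrightarrow>
     bilinear g \<and> (\<forall>X Y. g X Y = g Y X) \<and> (\<forall>X. (\<forall>Y. g X Y = 0) \<longrightarrow> X = 0)"

lemma metric_represents_unique:
  fixes g :: "'a::real_vector \<Rightarrow> 'a \<Rightarrow> real"
  assumes fin: "\<exists>B :: 'a set. finite B \<and> span B = UNIV"
    and g: "nondeg_sym_form g" and f: "linear f"
  shows "\<exists>!W. \<forall>Z. g W Z = f Z"
proof -
  obtain B0 :: "'a set" where B0: "finite B0" "span B0 = UNIV" using fin by blast
  obtain B where B: "B \<subseteq> B0" "independent B" "B0 \<subseteq> span B"
    using maximal_independent_subset by blast
  have finB: "finite B" using B B0 finite_subset by blast
  have spanB: "span B = UNIV"
    using B(3) B0(2) span_minimal[of B0 "span B"] subspace_span by auto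
  interpret F: finite_dimensional_vector_space "scaleR :: real \<Rightarrow> 'a \<Rightarrow> 'a" B
    using finB spanB B(2)
    by unfold_locales (auto simp: scaleR_add_right scaleR_add_left dependent_raw_def span_raw_def)
  have lin1: "linear (\<lambda>W. g W Z)" and lin2: "linear (g W)" for W Z
    using g by (auto simp: nondeg_sym_form_def bilinear_def)
  define T where "T W = (\<Sum>b\<in>B. g W b *\<^sub>R b)" for W
  have linT: "linear T"
    by (rule linearI)
      (auto simp: T_def linear_add[OF lin1] linear_scale[OF lin1] scaleR_add_left
        sum.distrib scaleR_sum_right)
  have coeff: "\<forall>b\<in>B. u b = v b"
    if "(\<Sum>b\<in>B. u b *\<^sub>R b) = (\<Sum>b\<in>B. v b *\<^sub>R b)" for u v :: "'a \<Rightarrow> real"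
  proof -
    have "(\<Sum>b\<in>B. (u b - v b) *\<^sub>R b) = 0"
      using that by (simp add: scaleR_diff_left sum_subtractf)
    then show ?thesis
      using independentD[OF B(2) finB subset_refl] by fastforce
  qed
  have ext: "f1 = f2" if "linear f1" "linear f2" "\<forall>b\<in>B. f1 b = f2 b" for f1 f2 :: "'a \<Rightarrow> real"
    using linear_eq_on_span[OF that(1,2), of B] that(3) spanB by fastforce
  have nondeg: "W = W'" if "\<forall>Z. g W Z = g W' Z" for W W'
  proof -
    have "\<forall>Z. g (W - W') Z = 0"
      using that by (simp add: linear_diff[OF lin1])
    then have "W - W' = 0" using g unfolding nondeg_sym_form_def by blast
    then show ?thesis by simp
  qed
  have "inj T"
  proof (rule injI)
    fix W W' assume "T W = T W'"
    then have "\<forall>b\<in>B. g W b = g W' b" unfolding T_def by (rule coeff)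
    then have "g W = g W'" by (rule ext[OF lin2 lin2])
    then show "W = W'" using nondeg by simp
  qed
  then have "surj T"
    using F.linear_inj_imp_surj linT by (simp add: linear_def)
  then obtain W where "T W = (\<Sum>b\<in>B. f b *\<^sub>R b)" by (metis surjD)
  then have "\<forall>b\<in>B. g W b = f b" unfolding T_def by (rule coeff)
  then have "g W = f" by (rule ext[OF lin2 f])
  then show ?thesis using nondeg by (intro ex1I[of _ W]) auto
qed

definition levi_civita ::
  "('a::real_vector \<Rightarrow> 'a \<Rightarrow> 'a) \<Rightarrow> ('a \<Rightarrow> 'a \<Rightarrow> real) \<Rightarrow> 'a \<Rightarrow> 'a \<Rightarrow> 'a" where
  "levi_civita br g X Y =
     (THE W. \<forall>Z. 2 * g W Z = g (br X Y) Z - g Y (br X Z) - g X (br Y Z))"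

lemma levi_civita_koszul:
  assumes "lie_algebra br" "nondeg_sym_form g"
  shows "2 * g (levi_civita br g X Y) Z = g (br X Y) Z - g Y (br X Z) - g X (br Y Z)"
proof -
  define f where "f Z = (g (br X Y) Z - g Y (br X Z) - g X (br Y Z)) / 2" for Z
  have g: "linear (g W)" and br: "linear (br W)" for W
    using assms by (auto simp: nondeg_sym_form_def lie_algebra_def lie_bracket_def bilinear_def)
  have "linear f"
    by (rule linearI)
      (simp_all add: f_def linear_add[OF g] linear_scale[OF g] linear_add[OF br]
        linear_scale[OF br] field_simps)
  then have "\<exists>!W. \<forall>Z. g W Z = f Z"
    using assms by (intro metric_represents_unique) (auto simp: lie_algebra_def)
  moreover have "(\<forall>Z. g W Z = f Z) \<longleftrightarrow>
      (\<forall>Z. 2 * g W Z = g (br X Y) Z - g Y (br X Z) - g X (br Y Z))" for W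
    by (auto simp: f_def field_simps)
  ultimately have "\<exists>!W. \<forall>Z. 2 * g W Z = g (br X Y) Z - g Y (br X Z) - g X (br Y Z)"
    by simp
  from theI'[OF this] show ?thesis unfolding levi_civita_def by blast
qed

definition pseudo_kaehler ::
  "('a::real_vector \<Rightarrow> 'a \<Rightarrow> 'a) \<Rightarrow> ('a \<Rightarrow> 'a \<Rightarrow> real) \<Rightarrow> ('a \<Rightarrow> 'a) \<Rightarrow> bool" where
  "pseudo_kaehler br g J \<longleftrightarrow>
     lie_algebra br \<and> nondeg_sym_form g \<and>
     linear J \<and> (\<forall>X. J (J X) = - X) \<and> (\<forall>X Y. g (J X) (J Y) = g X Y) \<and>
     (\<forall>X Y. levi_civita br g X (J Y) = J (levi_civita br g X Y))"

definition derivation :: "('a::real_vector \<Rightarrow> 'a \<Rightarrow> 'a) \<Rightarrow> ('a \<Rightarrow> 'a) \<Rightarrow> bool" where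
  "derivation br D \<longleftrightarrow> linear D \<and> (\<forall>X Y. D (br X Y) = br (D X) Y + br X (D Y))"

text \<open>A Lie algebra homomorphism from \<open>(\<hh>, brh)\<close> into the Lie algebra of derivations of
  \<open>(\<gg>, brg)\<close> with the commutator bracket; the second conjunct is linearity in \<open>A\<close>.\<close>

definition der_representation ::
  "('b::real_vector \<Rightarrow> 'b \<Rightarrow> 'b) \<Rightarrow> ('a::real_vector \<Rightarrow> 'a \<Rightarrow> 'a) \<Rightarrow> ('b \<Rightarrow> 'a \<Rightarrow> 'a) \<Rightarrow> bool" where
  "der_representation brh brg \<phi> \<longleftrightarrow>
     (\<forall>A. derivation brg (\<phi> A)) \<and>
     (\<forall>X. linear (\<lambda>A. \<phi> A X)) \<and>
     (\<forall>A B X. \<phi> (brh A B) X = \<phi> A (\<phi> B X) - \<phi> B (\<phi> A X))"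

definition semidirect_bracket ::
  "('a::real_vector \<Rightarrow> 'a \<Rightarrow> 'a) \<Rightarrow> ('b::real_vector \<Rightarrow> 'b \<Rightarrow> 'b) \<Rightarrow> ('b \<Rightarrow> 'a \<Rightarrow> 'a)
     \<Rightarrow> 'a \<times> 'b \<Rightarrow> 'a \<times> 'b \<Rightarrow> 'a \<times> 'b" where
  "semidirect_bracket brg brh \<phi> =
     (\<lambda>(X, A) (Y, B). (brg X Y + \<phi> A Y - \<phi> B X, brh A B))"

definition sum_metric ::
  "('a \<Rightarrow> 'a \<Rightarrow> real) \<Rightarrow> ('b \<Rightarrow> 'b \<Rightarrow> real) \<Rightarrow> 'a \<times> 'b \<Rightarrow> 'a \<times> 'b \<Rightarrow> real" where
  "sum_metric g h = (\<lambda>(X, A) (Y, B). g X Y + h A B)"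

definition metric_adjoint ::
  "('a::real_vector \<Rightarrow> 'a \<Rightarrow> real) \<Rightarrow> ('a \<Rightarrow> 'a) \<Rightarrow> 'a \<Rightarrow> 'a" where
  "metric_adjoint g f = (THE f'. \<forall>X Y. g (f X) Y = g X (f' Y))"

lemma metric_adjoint:
  fixes g :: "'a::real_vector \<Rightarrow> 'a \<Rightarrow> real"
  assumes fin: "\<exists>B :: 'a set. finite B \<and> span B = UNIV"
    and g: "nondeg_sym_form g" and f: "linear f"
  shows "g (f X) Y = g X (metric_adjoint g f Y)"
proof -
  have sym: "g U V = g V U" for U V using g by (auto simp: nondeg_sym_form_def)
  have lin: "linear (\<lambda>X. g (f X) Y)" for Y
    using linear_compose[OF f, of "\<lambda>W. g W Y"] g
    by (simp add: nondeg_sym_form_def bilinear_def o_def)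
  have ex: "\<exists>!W. \<forall>X. g (f X) Y = g X W" for Y
    using metric_represents_unique[OF fin g lin[of Y]] by (simp add: sym eq_commute)
  have "\<exists>!f'. \<forall>X Y. g (f X) Y = g X (f' Y)"
  proof (rule ex_ex1I)
    show "\<exists>f'. \<forall>X Y. g (f X) Y = g X (f' Y)"
      using ex by metis
    show "f1 = f2"
      if "\<forall>X Y. g (f X) Y = g X (f1 Y)" "\<forall>X Y. g (f X) Y = g X (f2 Y)" for f1 f2
      using that ex by (intro ext) metis
  qed
  from theI'[OF this] show ?thesis unfolding metric_adjoint_def by blast
qed

definition sym_part ::
  "('a::real_vector \<Rightarrow> 'a \<Rightarrow> real) \<Rightarrow> ('a \<Rightarrow> 'a) \<Rightarrow> 'a \<Rightarrow> 'a" where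
  "sym_part g f X = (1/2) *\<^sub>R (f X + metric_adjoint g f X)"

definition antisym_part ::
  "('a::real_vector \<Rightarrow> 'a \<Rightarrow> real) \<Rightarrow> ('a \<Rightarrow> 'a) \<Rightarrow> 'a \<Rightarrow> 'a" where
  "antisym_part g f X = (1/2) *\<^sub>R (f X - metric_adjoint g f X)"

end

theory Submission
  imports Defs
begin

text \<open>
  Everything rests on the Levi-Civita connection of the orthogonal sum metric on the semidirect
  product. Since \<open>\<gg>\<close> is an ideal, the Koszul formula yields for \<open>X + A\<close> and \<open>Y + B\<close>

    \<open>\<nabla>\<^bsub>X+A\<^esub>(Y + B) = (\<nabla>\<^sup>g\<^sub>X Y - \<phi>(B)\<^sup>s X + \<phi>(A)\<^sup>a Y) + (\<nabla>\<^sup>h\<^sub>A B + S(X, Y))\<close>,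

  where the first bracket lies in \<open>\<gg>\<close>, the second in \<open>\<hh>\<close>, and \<open>S(X, Y)\<close> is determined by
  \<open>h(S(X, Y), C) = g(\<phi>(C)\<^sup>s X, Y)\<close> for all \<open>C\<close> (lemmas \<open>fst_levi_civita_semidirect\<close> and
  \<open>snd_levi_civita_semidirect\<close>).

  Compare \<open>\<nabla>(J(Y + B))\<close> with \<open>J(\<nabla>(Y + B))\<close>. The two original connections cancel because they
  commute with their complex structures, so the components in \<open>\<gg>\<close> agree iff

    \<open>- \<phi>(J\<^sub>h B)\<^sup>s X + \<phi>(A)\<^sup>a (J\<^sub>g Y) = - J\<^sub>g (\<phi>(B)\<^sup>s X) + J\<^sub>g (\<phi>(A)\<^sup>a Y)\<close>.

  The first terms on both sides involve only \<open>X\<close> and \<open>B\<close>, the second ones only \<open>Y\<close> and \<open>A\<close>, so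
  this holds identically iff the two stated conditions hold. The components in \<open>\<hh>\<close> then
  agree as well: \<open>S(X, J\<^sub>g Y) = J\<^sub>h S(X, Y)\<close> follows from the condition on symmetric parts by pairing
  with \<open>C\<close> and moving the skew-adjoint maps \<open>J\<^sub>g\<close> and \<open>J\<^sub>h\<close> to the other side. The remaining
  clauses of the definition of a pseudo-Kaehler Lie algebra hold for every representation \<open>\<phi>\<close>
  by derivations.
\<close>

section \<open>Non-degenerate forms and adjoints\<close>

lemma nondeg_sym_form_eqI:
  assumes "nondeg_sym_form g" and "\<And>Z. g V Z = g W Z"
  shows "V = W"
proof -
  have "bilinear g"
    using assms(1) by (simp add: nondeg_sym_form_def)
  then have "\<forall>Z. g (V - W) Z = 0"
    using assms(2) by (simp add: bilinear_lsub)
  then show ?thesis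
    using assms(1) by (metis nondeg_sym_form_def right_minus_eq)
qed

text \<open>Pairing with a test vector eliminates the adjoint; all later computations use only
  these weak forms of the two parts.\<close>

lemma sym_part_weak:
  fixes g :: "'a::real_vector \<Rightarrow> 'a \<Rightarrow> real"
  assumes "\<exists>B :: 'a set. finite B \<and> span B = UNIV" "nondeg_sym_form g" "linear f"
  shows "2 * g (sym_part g f X) Z = g (f X) Z + g X (f Z)"
proof -
  have b: "bilinear g" and sym: "\<And>U V. g U V = g V U"
    using assms(2) by (auto simp: nondeg_sym_form_def)
  have "g (metric_adjoint g f X) Z = g X (f Z)"
    using metric_adjoint[OF assms, of Z X] sym by metis
  then show ?thesis
    by (simp add: sym_part_def bilinear_lmul[OF b] bilinear_ladd[OF b])
qed

lemma antisym_part_weak: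
  fixes g :: "'a::real_vector \<Rightarrow> 'a \<Rightarrow> real"
  assumes "\<exists>B :: 'a set. finite B \<and> span B = UNIV" "nondeg_sym_form g" "linear f"
  shows "2 * g (antisym_part g f X) Z = g (f X) Z - g X (f Z)"
proof -
  have b: "bilinear g" and sym: "\<And>U V. g U V = g V U"
    using assms(2) by (auto simp: nondeg_sym_form_def)
  have "g (metric_adjoint g f X) Z = g X (f Z)"
    using metric_adjoint[OF assms, of Z X] sym by metis
  then show ?thesis
    by (simp add: antisym_part_def bilinear_lmul[OF b] bilinear_lsub[OF b])
qed

lemma sym_part_zero:
  fixes g :: "'a::real_vector \<Rightarrow> 'a \<Rightarrow> real"
  assumes "\<exists>B :: 'a set. finite B \<and> span B = UNIV" "nondeg_sym_form g" "linear f"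
  shows "sym_part g f 0 = 0"
proof (rule nondeg_sym_form_eqI[OF assms(2)])
  have "bilinear g" using assms(2) by (simp add: nondeg_sym_form_def)
  then show "g (sym_part g f 0) Z = g 0 Z" for Z
    using sym_part_weak[OF assms, of 0 Z] by (simp add: linear_0[OF assms(3)] bilinear_lzero)
qed

lemma antisym_part_zero:
  fixes g :: "'a::real_vector \<Rightarrow> 'a \<Rightarrow> real"
  assumes "\<exists>B :: 'a set. finite B \<and> span B = UNIV" "nondeg_sym_form g" "linear f"
  shows "antisym_part g f 0 = 0"
proof (rule nondeg_sym_form_eqI[OF assms(2)])
  have "bilinear g" using assms(2) by (simp add: nondeg_sym_form_def)
  then show "g (antisym_part g f 0) Z = g 0 Z" for Z
    using antisym_part_weak[OF assms, of 0 Z]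
    by (simp add: linear_0[OF assms(3)] bilinear_lzero)
qed

lemma complex_structure_skew:
  fixes g :: "'a::real_vector \<Rightarrow> 'a \<Rightarrow> real"
  assumes "bilinear g" "\<And>X. J (J X) = - X" "\<And>X Y. g (J X) (J Y) = g X Y"
  shows "g (J X) Y = - g X (J Y)"
proof -
  have "g (J X) (J (J Y)) = - g (J X) Y"
    by (simp add: assms(2) bilinear_rneg[OF assms(1)])
  with assms(3)[of X "J Y"] show ?thesis by linarith
qed

section \<open>The semidirect product as a metric Lie algebra\<close>

lemma finite_span_Times:
  assumes "\<exists>B :: 'a::real_vector set. finite B \<and> span B = UNIV"
    and "\<exists>B :: 'b::real_vector set. finite B \<and> span B = UNIV"
  shows "\<exists>B :: ('a \<times> 'b) set. finite B \<and> span B = UNIV"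
proof -
  obtain B :: "'a set" and C :: "'b set"
    where BC: "finite B" "span B = UNIV" "finite C" "span C = UNIV"
    using assms by blast
  let ?D = "(\<lambda>x. (x, 0)) ` B \<union> (\<lambda>y. (0, y)) ` C"
  have l: "linear (\<lambda>x::'a. (x, 0::'b))" and r: "linear (\<lambda>y::'b. (0::'a, y))"
    by (auto intro!: linearI)
  have "p \<in> span ?D" for p :: "'a \<times> 'b"
  proof -
    have "(fst p, 0) \<in> (\<lambda>x. (x, 0)) ` span B" "(0, snd p) \<in> (\<lambda>y. (0, y)) ` span C"
      using BC by auto
    then have "(fst p, 0) \<in> span ?D" "(0, snd p) \<in> span ?D"
      using span_mono[of "(\<lambda>x. (x, 0)) ` B" ?D] span_mono[of "(\<lambda>y. (0, y)) ` C" ?D]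
      unfolding linear_span_image[OF l] linear_span_image[OF r] by blast+
    from span_add[OF this] show ?thesis by simp
  qed
  then have "span ?D = UNIV" by blast
  with BC show ?thesis by (intro exI[of _ ?D]) simp
qed

lemma nondeg_sym_form_sum_metric:
  assumes "nondeg_sym_form g" "nondeg_sym_form h"
  shows "nondeg_sym_form (sum_metric g h)"
proof -
  have b: "bilinear g" "bilinear h" using assms by (auto simp: nondeg_sym_form_def)
  have "bilinear (sum_metric g h)"
    unfolding bilinear_def sum_metric_def using b
    by (auto intro!: linearI
        simp: bilinear_ladd bilinear_radd bilinear_lmul bilinear_rmul algebra_simps)
  moreover have "sum_metric g h p q = sum_metric g h q p" for p q
    using assms by (simp add: sum_metric_def nondeg_sym_form_def split: prod.splits)
  moreover have "p = 0" if "\<forall>q. sum_metric g h p q = 0" for p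
  proof -
    have "g (fst p) Y = 0" for Y
      using spec[OF that, of "(Y, 0)"] b by (simp add: sum_metric_def split_beta bilinear_rzero)
    moreover have "h (snd p) B = 0" for B
      using spec[OF that, of "(0, B)"] b by (simp add: sum_metric_def split_beta bilinear_rzero)
    ultimately show ?thesis
      using assms unfolding nondeg_sym_form_def by (metis prod_eq_iff fst_zero snd_zero)
  qed
  ultimately show ?thesis unfolding nondeg_sym_form_def by blast
qed

text \<open>In the Jacobi identity the terms with two entries from \<open>\<gg>\<close> cancel because each
  \<open>\<phi>(A)\<close> is a derivation, those with one entry from \<open>\<gg>\<close> because \<open>\<phi>\<close> preserves brackets.\<close>

lemma lie_bracket_semidirect:
  assumes "lie_bracket brg" "lie_bracket brh" "der_representation brh brg \<phi>"
  shows "lie_bracket (semidirect_bracket brg brh \<phi>)"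
proof -
  have bg: "bilinear brg" and bh: "bilinear brh"
    using assms by (auto simp: lie_bracket_def)
  have alt_g: "brg X X = 0" and alt_h: "brh A A = 0" for X A
    using assms by (auto simp: lie_bracket_def)
  have jac_g: "brg X (brg Y Z) + brg Y (brg Z X) + brg Z (brg X Y) = 0" for X Y Z
    using assms by (auto simp: lie_bracket_def)
  have jac_h: "brh X (brh Y Z) + brh Y (brh Z X) + brh Z (brh X Y) = 0" for X Y Z
    using assms by (auto simp: lie_bracket_def)
  have der: "\<phi> A (brg X Y) = brg (\<phi> A X) Y + brg X (\<phi> A Y)" for A X Y
    using assms by (auto simp: der_representation_def derivation_def)
  have hom: "\<phi> (brh A B) X = \<phi> A (\<phi> B X) - \<phi> B (\<phi> A X)" for A B X
    using assms by (auto simp: der_representation_def)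
  have lin: "linear (\<phi> A)" "linear (\<lambda>A. \<phi> A X)" for A X
    using assms by (auto simp: der_representation_def derivation_def)
  note lin_simps = linear_add[OF lin(1)] linear_add[OF lin(2)] linear_diff[OF lin(1)]
    linear_scale[OF lin(1)] linear_scale[OF lin(2)]
    bilinear_ladd[OF bg] bilinear_ladd[OF bh] bilinear_radd[OF bg] bilinear_radd[OF bh]
    bilinear_lmul[OF bg] bilinear_lmul[OF bh] bilinear_rmul[OF bg] bilinear_rmul[OF bh]
    bilinear_rsub[OF bg]
  have anti: "brg Y X = - brg X Y" for X Y
  proof -
    have "brg (X + Y) (X + Y) = brg X Y + brg Y X"
      by (simp only: lin_simps) (simp add: alt_g)
    then show ?thesis
      using alt_g[of "X + Y"] minus_unique by metis
  qed
  have "bilinear (semidirect_bracket brg brh \<phi>)"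
    unfolding bilinear_def semidirect_bracket_def
    by (auto intro!: linearI simp: lin_simps algebra_simps)
  moreover have "semidirect_bracket brg brh \<phi> p p = 0" for p
    by (simp add: semidirect_bracket_def split_beta alt_g alt_h zero_prod_def)
  moreover have "semidirect_bracket brg brh \<phi> p (semidirect_bracket brg brh \<phi> q r)
      + semidirect_bracket brg brh \<phi> q (semidirect_bracket brg brh \<phi> r p)
      + semidirect_bracket brg brh \<phi> r (semidirect_bracket brg brh \<phi> p q) = 0" for p q r
  proof -
    obtain X A Y B Z C where [simp]: "p = (X, A)" "q = (Y, B)" "r = (Z, C)"
      by (metis surj_pair)
    \<comment> \<open>These swaps give the terms from the derivation rule the order in which they cancel.\<close>
    have "brg (\<phi> A Y) Z = - brg Z (\<phi> A Y)" "brg (\<phi> B Z) X = - brg X (\<phi> B Z)"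
      "brg (\<phi> C X) Y = - brg Y (\<phi> C X)"
      using anti by blast+
    then show ?thesis
      using jac_g[of X Y Z] jac_h[of A B C]
      by (simp add: semidirect_bracket_def zero_prod_def lin_simps der hom algebra_simps)
  qed
  ultimately show ?thesis by (simp add: lie_bracket_def)
qed

lemma lie_algebra_semidirect:
  fixes brg :: "'a::real_vector \<Rightarrow> 'a \<Rightarrow> 'a" and brh :: "'b::real_vector \<Rightarrow> 'b \<Rightarrow> 'b"
  assumes "lie_algebra brg" "lie_algebra brh" "der_representation brh brg \<phi>"
  shows "lie_algebra (semidirect_bracket brg brh \<phi>)"
  using assms lie_bracket_semidirect[OF _ _ assms(3)]
    finite_span_Times[where 'a = 'a and 'b = 'b]
  by (simp add: lie_algebra_def)

section \<open>The Levi-Civita connection of the semidirect product\<close>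

text \<open>The component in \<open>\<gg>\<close> is found by putting test vectors \<open>(Z, 0)\<close> in the Koszul formula, the
  one in \<open>\<hh>\<close> by putting \<open>(0, C)\<close>.\<close>

lemma fst_levi_civita_semidirect:
  assumes lg: "lie_algebra brg" and ng: "nondeg_sym_form g"
    and lh: "lie_algebra brh" and nh: "nondeg_sym_form h"
    and rep: "der_representation brh brg \<phi>"
  shows "fst (levi_civita (semidirect_bracket brg brh \<phi>) (sum_metric g h) (X, A) (Y, B))
    = levi_civita brg g X Y - sym_part g (\<phi> B) X + antisym_part g (\<phi> A) Y"
    (is "fst ?W = ?V")
proof (rule nondeg_sym_form_eqI[OF ng])
  fix Z
  have fin: "\<exists>B :: 'a set. finite B \<and> span B = UNIV"
    using lg by (simp add: lie_algebra_def)
  have bg: "bilinear g" and bh: "bilinear h" and bbh: "bilinear brh"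
    using ng nh lh by (auto simp: nondeg_sym_form_def lie_algebra_def lie_bracket_def)
  have lin: "linear (\<phi> A)" "linear (\<lambda>A. \<phi> A X)" for A X
    using rep by (auto simp: der_representation_def derivation_def)
  note b_simps = bilinear_ladd[OF bg] bilinear_radd[OF bg] bilinear_lsub[OF bg]
    bilinear_rsub[OF bg] bilinear_rzero[OF bh] bilinear_rzero[OF bbh] linear_0[OF lin(2)]
  show "g (fst ?W) Z = g ?V Z"
    using levi_civita_koszul[OF lie_algebra_semidirect[OF lg lh rep]
        nondeg_sym_form_sum_metric[OF ng nh], of "(X, A)" "(Y, B)" "(Z, 0)"]
      levi_civita_koszul[OF lg ng, of X Y Z]
      sym_part_weak[OF fin ng lin(1), of B X Z] antisym_part_weak[OF fin ng lin(1), of A Y Z]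
    by (simp add: semidirect_bracket_def sum_metric_def split_beta b_simps)
qed

lemma snd_levi_civita_semidirect:
  assumes lg: "lie_algebra brg" and ng: "nondeg_sym_form g"
    and lh: "lie_algebra brh" and nh: "nondeg_sym_form h"
    and rep: "der_representation brh brg \<phi>"
  shows "h (snd (levi_civita (semidirect_bracket brg brh \<phi>) (sum_metric g h) (X, A) (Y, B))) C
    = h (levi_civita brh h A B) C + g (sym_part g (\<phi> C) X) Y"
proof -
  have fin: "\<exists>B :: 'a set. finite B \<and> span B = UNIV"
    using lg by (simp add: lie_algebra_def)
  have bg: "bilinear g" and bbg: "bilinear brg"
    using ng lg by (auto simp: nondeg_sym_form_def lie_algebra_def lie_bracket_def)
  have sym: "g U V = g V U" for U V using ng by (auto simp: nondeg_sym_form_def)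
  have lin: "linear (\<phi> A)" for A
    using rep by (auto simp: der_representation_def derivation_def)
  note b_simps = bilinear_rneg[OF bg] bilinear_rzero[OF bg] bilinear_rzero[OF bbg]
    linear_0[OF lin]
  show ?thesis
    using levi_civita_koszul[OF lie_algebra_semidirect[OF lg lh rep]
        nondeg_sym_form_sum_metric[OF ng nh], of "(X, A)" "(Y, B)" "(0, C)"]
      levi_civita_koszul[OF lh nh, of A B C]
      sym_part_weak[OF fin ng lin, of C X Y] sym[of Y "\<phi> C X"]
    by (simp add: semidirect_bracket_def sum_metric_def split_beta b_simps)
qed

section \<open>Parallelism of the complex structure\<close>

theorem theorem1p3:
  fixes brg :: "'a::real_vector \<Rightarrow> 'a \<Rightarrow> 'a"
    and g :: "'a \<Rightarrow> 'a \<Rightarrow> real"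
    and Jg :: "'a \<Rightarrow> 'a"
    and brh :: "'b::real_vector \<Rightarrow> 'b \<Rightarrow> 'b"
    and h :: "'b \<Rightarrow> 'b \<Rightarrow> real"
    and Jh :: "'b \<Rightarrow> 'b"
    and \<phi> :: "'b \<Rightarrow> 'a \<Rightarrow> 'a"
  assumes "pseudo_kaehler brg g Jg"
    and "pseudo_kaehler brh h Jh"
    and "der_representation brh brg \<phi>"
  shows "pseudo_kaehler (semidirect_bracket brg brh \<phi>) (sum_metric g h) (map_prod Jg Jh)
    \<longleftrightarrow> (\<forall>A. Jg \<circ> sym_part g (\<phi> A) = sym_part g (\<phi> (Jh A)) \<and>
             Jg \<circ> antisym_part g (\<phi> A) = antisym_part g (\<phi> A) \<circ> Jg)"
proof -
  have lg: "lie_algebra brg" and ng: "nondeg_sym_form g" and Jg: "linear Jg"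
    and Jg2: "\<And>X. Jg (Jg X) = - X" and Jg_iso: "\<And>X Y. g (Jg X) (Jg Y) = g X Y"
    and par_g: "\<And>X Y. levi_civita brg g X (Jg Y) = Jg (levi_civita brg g X Y)"
    using assms(1) by (auto simp: pseudo_kaehler_def)
  have lh: "lie_algebra brh" and nh: "nondeg_sym_form h" and Jh: "linear Jh"
    and Jh2: "\<And>X. Jh (Jh X) = - X" and Jh_iso: "\<And>X Y. h (Jh X) (Jh Y) = h X Y"
    and par_h: "\<And>X Y. levi_civita brh h X (Jh Y) = Jh (levi_civita brh h X Y)"
    using assms(2) by (auto simp: pseudo_kaehler_def)
  have bg: "bilinear g" and bh: "bilinear h"
    using ng nh by (auto simp: nondeg_sym_form_def)
  have fin: "\<exists>B :: 'a set. finite B \<and> span B = UNIV"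
    using lg by (simp add: lie_algebra_def)
  have lin: "linear (\<phi> A)" for A
    using assms(3) by (auto simp: der_representation_def derivation_def)
  have skew_g: "g (Jg X) Y = - g X (Jg Y)" for X Y
    using bg Jg2 Jg_iso by (rule complex_structure_skew[of g Jg])
  have skew_h: "h (Jh A) B = - h A (Jh B)" for A B
    using bh Jh2 Jh_iso by (rule complex_structure_skew[of h Jh])
  let ?nabla = "levi_civita (semidirect_bracket brg brh \<phi>) (sum_metric g h)"
  let ?J = "map_prod Jg Jh"
  note fst_nabla = fst_levi_civita_semidirect[OF lg ng lh nh assms(3)]
  note snd_nabla = snd_levi_civita_semidirect[OF lg ng lh nh assms(3)]
  have "linear ?J"
    by (auto intro!: linearI simp: linear_add[OF Jg] linear_add[OF Jh]
        linear_scale[OF Jg] linear_scale[OF Jh])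
  moreover have "\<forall>p. ?J (?J p) = - p"
    by (simp add: Jg2 Jh2)
  moreover have "\<forall>p q. sum_metric g h (?J p) (?J q) = sum_metric g h p q"
    by (simp add: sum_metric_def Jg_iso Jh_iso)
  ultimately have reduce: "pseudo_kaehler (semidirect_bracket brg brh \<phi>) (sum_metric g h) ?J
      \<longleftrightarrow> (\<forall>p q. ?nabla p (?J q) = ?J (?nabla p q))"
    using lie_algebra_semidirect[OF lg lh assms(3)] nondeg_sym_form_sum_metric[OF ng nh]
    unfolding pseudo_kaehler_def by simp
  have fst_iff: "fst (?nabla (X, A) (?J (Y, B))) = fst (?J (?nabla (X, A) (Y, B))) \<longleftrightarrow>
      - sym_part g (\<phi> (Jh B)) X + antisym_part g (\<phi> A) (Jg Y)
      = - Jg (sym_part g (\<phi> B) X) + Jg (antisym_part g (\<phi> A) Y)" for X A Y B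
    by (simp add: fst_nabla par_g linear_add[OF Jg] linear_diff[OF Jg])
  have snd_eq: "snd (?nabla (X, A) (?J (Y, B))) = snd (?J (?nabla (X, A) (Y, B)))"
    if s: "\<And>A. Jg \<circ> sym_part g (\<phi> A) = sym_part g (\<phi> (Jh A))" for X A Y B
  proof (rule nondeg_sym_form_eqI[OF nh])
    fix C
    have "g (sym_part g (\<phi> C) X) (Jg Y) = - g (sym_part g (\<phi> (Jh C)) X) Y"
      using fun_cong[OF s[of C], of X] skew_g[of "sym_part g (\<phi> C) X" Y] by simp
    then show "h (snd (?nabla (X, A) (?J (Y, B)))) C = h (snd (?J (?nabla (X, A) (Y, B)))) C"
      by (simp add: snd_nabla par_h skew_h)
  qed
  show ?thesis
    unfolding reduce
  proof (intro iffI allI conjI)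
    fix A
    assume par: "\<forall>p q. ?nabla p (?J q) = ?J (?nabla p q)"
    have eq: "- sym_part g (\<phi> (Jh B)) X + antisym_part g (\<phi> A) (Jg Y)
      = - Jg (sym_part g (\<phi> B) X) + Jg (antisym_part g (\<phi> A) Y)" for X A Y B
      unfolding fst_iff[symmetric] using par by simp
    \<comment> \<open>\<open>Y = 0\<close> isolates the terms with \<open>X\<close>, and \<open>X = 0\<close> those with \<open>Y\<close>.\<close>
    show "Jg \<circ> sym_part g (\<phi> A) = sym_part g (\<phi> (Jh A))"
    proof
      show "(Jg \<circ> sym_part g (\<phi> A)) X = sym_part g (\<phi> (Jh A)) X" for X
        using eq[of A X A 0] by (simp add: linear_0[OF Jg] antisym_part_zero[OF fin ng lin])
    qed
    show "Jg \<circ> antisym_part g (\<phi> A) = antisym_part g (\<phi> A) \<circ> Jg"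
    proof
      show "(Jg \<circ> antisym_part g (\<phi> A)) Y = (antisym_part g (\<phi> A) \<circ> Jg) Y" for Y
        using eq[of A 0 A Y] by (simp add: linear_0[OF Jg] sym_part_zero[OF fin ng lin])
    qed
  next
    fix p q :: "'a \<times> 'b"
    assume c: "\<forall>A. Jg \<circ> sym_part g (\<phi> A) = sym_part g (\<phi> (Jh A)) \<and>
             Jg \<circ> antisym_part g (\<phi> A) = antisym_part g (\<phi> A) \<circ> Jg"
    obtain X Y :: 'a and A B :: 'b where pq: "p = (X, A)" "q = (Y, B)" by (metis surj_pair)
    have "Jg (sym_part g (\<phi> B) X) = sym_part g (\<phi> (Jh B)) X"
      "Jg (antisym_part g (\<phi> A) Y) = antisym_part g (\<phi> A) (Jg Y)"
      using fun_cong[OF conjunct1[OF spec[OF c, of B]], of X]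
        fun_cong[OF conjunct2[OF spec[OF c, of A]], of Y] by simp_all
    then have "fst (?nabla p (?J q)) = fst (?J (?nabla p q))"
      unfolding pq fst_iff by simp
    moreover have "snd (?nabla p (?J q)) = snd (?J (?nabla p q))"
      unfolding pq using c by (intro snd_eq) blast
    ultimately show "?nabla p (?J q) = ?J (?nabla p q)"
      by (rule prod_eqI)
  qed
qed

end
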